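(* For every set of formulas $\Gamma$ and every formula $A$: $\Gamma \vdash_{\mathcal{H}_{\textsf{K}}} A$ if and only if $\Gamma \vDash_{\mathcal{RM}_{\textsf{K}}} A$.
   Context: The language has a denumerable set of propositional variables, unary connectives $\neg$ and $\ominus$, and a binary connective $\to$; formulas are built freely. The Hilbert calculus $\mathcal{H}_{\textsf{K}}$ has axiom schemas (Ax1) $A \to (B \to A)$; (Ax2) $(A \to (B \to C)) \to ((A \to B) \to (A \to C))$; (Ax3) $(\neg B \to \neg A) \to (A \to B)$; (K) $\ominus(A \to B) \to (\ominus A \to \ominus B)$, and Modus Ponens as the only rule; $\Gamma \vdash_{\mathcal{H}_{\textsf{K}}} A$ means there is a finite sequence ending in $A$ each member of which is in $\Gamma$, an axiom instance, or obtained by Modus Ponens from earlier members. Semantics: truth-values are pairs $V_4=\{0,1\}^2$ with designated set $D_4=\{(1,0),(1,1)\}$. A valuation is a map $v=(v_1,v_2)$ from formulas to $V_4$ such that for all formulas $A,B$: $v_1(\neg A)=1-v_1(A)$; $v_1(\ominus A)=v_2(A)$; $v_1(A\to B)=v_1(A)\Rightarrow v_1(B)$ (Boolean implication), with $v_2$ otherwise unconstrained (these are exactly the valuations of the 4-valued non-deterministic matrix $\mathcal{M}$ with $\tilde\neg z=\{(1-z_1,* )\}$, $\tilde\ominus z=\{(z_2,* )\}$, $z\,\tilde\to\,w=\{(z_1\Rightarrow w_1,* )\}$, $*$ arbitrary). Let $\mathcal{F}$ be the set of all valuations and $\mathcal{F}_{\textsf{K}}=\{v\in\mathcal{F}: v_2(A\to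 B)\le v_2(A)\Rightarrow v_2(B)\text{ for all formulas }A,B\}$. The restricted non-deterministic matrix $\mathcal{RM}_{\textsf{K}}=\langle \mathcal{M},\mathcal{F}_{\textsf{K}}\rangle$ induces the consequence relation: $\Gamma \vDash_{\mathcal{RM}_{\textsf{K}}} A$ iff for every $v\in\mathcal{F}_{\textsf{K}}$, if $v(B)\in D_4$ for all $B\in\Gamma$ then $v(A)\in D_4$. *)

theory Defs
  imports Main
begin

datatype fm =
    Var nat
  | Neg fm  ("\<^bold>\<not> _" [70] 70)
  | Omin fm  ("\<ominus> _" [70] 70)
  | Imp fm fm  (infixr "\<^bold>\<rightarrow>" 55)


section \<open>The Hilbert calculus\<close>

inductive axiom_K :: "fm \<Rightarrow> bool" where
  Ax1: "axiom_K (A \<^bold>\<rightarrow> (B \<^bold>\<rightarrow> A))"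
| Ax2: "axiom_K ((A \<^bold>\<rightarrow> (B \<^bold>\<rightarrow> C)) \<^bold>\<rightarrow> ((A \<^bold>\<rightarrow> B) \<^bold>\<rightarrow> (A \<^bold>\<rightarrow> C)))"
| Ax3: "axiom_K ((\<^bold>\<not> B \<^bold>\<rightarrow> \<^bold>\<not> A) \<^bold>\<rightarrow> (A \<^bold>\<rightarrow> B))"
| K:   "axiom_K (\<ominus> (A \<^bold>\<rightarrow> B) \<^bold>\<rightarrow> (\<ominus> A \<^bold>\<rightarrow> \<ominus> B))"

definition derivation_K :: "fm set \<Rightarrow> fm list \<Rightarrow> bool" where
  "derivation_K \<Gamma> ps \<longleftrightarrow>
     (\<forall>i < length ps. ps ! i \<in> \<Gamma> \<or> axiom_K (ps ! i) \<or>
        (\<exists>j < i. \<exists>k < i. ps ! k = (ps ! j \<^bold>\<rightarrow> ps ! i)))"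

definition derives_K :: "fm set \<Rightarrow> fm \<Rightarrow> bool"  (infix "\<turnstile>\<^sub>K" 50) where
  "\<Gamma> \<turnstile>\<^sub>K A \<longleftrightarrow> (\<exists>ps. ps \<noteq> [] \<and> derivation_K \<Gamma> ps \<and> last ps = A)"


section \<open>Non-deterministic matrices and their restrictions\<close>

record 'v nmatrix =
  designated :: "'v set"
  neg_op :: "'v \<Rightarrow> 'v set"
  omin_op :: "'v \<Rightarrow> 'v set"
  imp_op :: "'v \<Rightarrow> 'v \<Rightarrow> 'v set"

definition nmatrix_valuations :: "'v nmatrix \<Rightarrow> (fm \<Rightarrow> 'v) set" where
  "nmatrix_valuations M =
     {v. \<forall>A B. v (\<^bold>\<not> A) \<in> neg_op M (v A) \<and> v (\<ominus> A) \<in> omin_op M (v A) \<and>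
             v (A \<^bold>\<rightarrow> B) \<in> imp_op M (v A) (v B)}"

text \<open>A restricted Nmatrix is an Nmatrix together with a set of admitted valuations.\<close>

type_synonym 'v rnmatrix = "'v nmatrix \<times> (fm \<Rightarrow> 'v) set"

definition rn_entails :: "'v rnmatrix \<Rightarrow> fm set \<Rightarrow> fm \<Rightarrow> bool" where
  "rn_entails R \<Gamma> A \<longleftrightarrow>
     (\<forall>v \<in> snd R. (\<forall>B \<in> \<Gamma>. v B \<in> designated (fst R)) \<longrightarrow> v A \<in> designated (fst R))"


section \<open>The four-valued semantics\<close>

text \<open>The bit 1 is \<open>True\<close> and 0 is \<open>False\<close>, so the order \<open>\<le>\<close> on bits is the library order
  on \<open>bool\<close>, complement is \<open>\<not>\<close> and Boolean implication is \<open>\<longrightarrow>\<close>.  All four pairs are truth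
  values, hence the set of truth values is the whole type.\<close>

type_synonym V4 = "bool \<times> bool"

definition D4 :: "V4 set" where
  "D4 = {(True, False), (True, True)}"

definition M4 :: "V4 nmatrix" where
  "M4 = \<lparr> designated = D4,
          neg_op = (\<lambda>z. {(\<not> fst z, b) | b. True}),
          omin_op = (\<lambda>z. {(snd z, b) | b. True}),
          imp_op = (\<lambda>z w. {(fst z \<longrightarrow> fst w, b) | b. True}) \<rparr>"

definition \<F> :: "(fm \<Rightarrow> V4) set" where
  "\<F> = {v. \<forall>A B. fst (v (\<^bold>\<not> A)) = (\<not> fst (v A)) \<and>
                fst (v (\<ominus> A)) = snd (v A) \<and>
                fst (v (A \<^bold>\<rightarrow> B)) = (fst (v A) \<longrightarrow> fst (v B))}"

lemma \<F>_eq_nmatrix_valuations: "\<F> = nmatrix_valuations M4"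
proof -
  have fst_iff: "x \<in> {(a, b) | b. True} \<longleftrightarrow> fst x = a" for x :: V4 and a
    by (cases x) auto
  show ?thesis
    unfolding \<F>_def nmatrix_valuations_def M4_def nmatrix.simps fst_iff ..
qed

definition \<F>\<^sub>K :: "(fm \<Rightarrow> V4) set" where
  "\<F>\<^sub>K = {v \<in> \<F>. \<forall>A B. snd (v (A \<^bold>\<rightarrow> B)) \<le> (snd (v A) \<longrightarrow> snd (v B))}"

definition RM\<^sub>K :: "V4 rnmatrix" where
  "RM\<^sub>K = (M4, \<F>\<^sub>K)"

abbreviation entails_K :: "fm set \<Rightarrow> fm \<Rightarrow> bool"  (infix "\<Turnstile>\<^sub>K" 50) where
  "\<Gamma> \<Turnstile>\<^sub>K A \<equiv> rn_entails RM\<^sub>K \<Gamma> A"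

end

theory Submission
  imports Defs
begin

text \<open>Completeness is a Lindenbaum argument: if \<open>\<Gamma>\<close> does not derive \<open>A\<close>, extend it to a set
  \<open>\<Delta>\<close> that is maximal with this property. Membership in \<open>\<Delta>\<close> is then a classical valuation, and
  \<open>v B = (B \<in> \<Delta>, \<ominus> B \<in> \<Delta>)\<close> is a countermodel. There is no necessitation rule, so the second
  bits are only constrained by axiom K, which is exactly the restriction that cuts out \<open>\<F>\<^sub>K\<close>.\<close>

text \<open>Rule induction over this relation replaces arguments about positions in a sequence;
  \<open>derives_K_iff_prov\<close> links the two notions.\<close>

inductive prov :: "fm set \<Rightarrow> fm \<Rightarrow> bool" for \<Gamma> where
  hyp: "A \<in> \<Gamma> \<Longrightarrow> prov \<Gamma> A"
| ax: "axiom_K A \<Longrightarrow> prov \<Gamma> A"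
| mp: "prov \<Gamma> (A \<^bold>\<rightarrow> B) \<Longrightarrow> prov \<Gamma> A \<Longrightarrow> prov \<Gamma> B"

lemma derivation_K_append:
  assumes "derivation_K \<Gamma> ps" "derivation_K \<Gamma> qs"
  shows "derivation_K \<Gamma> (ps @ qs)"
  unfolding derivation_K_def
proof (intro allI impI)
  fix i assume i: "i < length (ps @ qs)"
  show "(ps @ qs) ! i \<in> \<Gamma> \<or> axiom_K ((ps @ qs) ! i) \<or>
    (\<exists>j<i. \<exists>k<i. (ps @ qs) ! k = ((ps @ qs) ! j \<^bold>\<rightarrow> (ps @ qs) ! i))"
  proof (cases "i < length ps")
    case True
    then have "ps ! i \<in> \<Gamma> \<or> axiom_K (ps ! i) \<or>
        (\<exists>j<i. \<exists>k<i. ps ! k = (ps ! j \<^bold>\<rightarrow> ps ! i))"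
      using assms(1) by (auto simp: derivation_K_def)
    \<comment> \<open>The indices cited for position \<open>i\<close> lie below \<open>i\<close>, so
      they too fall within \<open>ps\<close>.\<close>
    moreover have "(ps @ qs) ! j = ps ! j" if "j \<le> i" for j
      using that True by (simp add: nth_append)
    ultimately show ?thesis
      by (metis le_refl less_imp_le)
  next
    case False
    define m where "m = i - length ps"
    have m: "i = length ps + m" "m < length qs"
      using False i by (auto simp: m_def)
    then consider "qs ! m \<in> \<Gamma> \<or> axiom_K (qs ! m)"
      | j k where "j < m" "k < m" "qs ! k = (qs ! j \<^bold>\<rightarrow> qs ! m)"
      using assms(2) by (auto simp: derivation_K_def)
    then show ?thesis
    proof cases
      case 1
      then show ?thesis using m by auto
    next
      case 2
      \<comment> \<open>Citations inside \<open>qs\<close> are shifted by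
        \<open>length ps\<close>.\<close>
      then have "length ps + j < i" "length ps + k < i"
        "(ps @ qs) ! (length ps + k) = ((ps @ qs) ! (length ps + j) \<^bold>\<rightarrow> (ps @ qs) ! i)"
        using m by auto
      then show ?thesis by blast
    qed
  qed
qed

lemma derivation_K_snoc:
  assumes "derivation_K \<Gamma> ps"
    and "A \<in> \<Gamma> \<or> axiom_K A \<or> (\<exists>B \<in> set ps. (B \<^bold>\<rightarrow> A) \<in> set ps)"
  shows "derivation_K \<Gamma> (ps @ [A])"
  unfolding derivation_K_def
proof (intro allI impI)
  fix i assume i: "i < length (ps @ [A])"
  show "(ps @ [A]) ! i \<in> \<Gamma> \<or> axiom_K ((ps @ [A]) ! i) \<or>
    (\<exists>j<i. \<exists>k<i. (ps @ [A]) ! k = ((ps @ [A]) ! j \<^bold>\<rightarrow> (ps @ [A]) ! i))"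
  proof (cases "i < length ps")
    case True
    then have "ps ! i \<in> \<Gamma> \<or> axiom_K (ps ! i) \<or>
        (\<exists>j<i. \<exists>k<i. ps ! k = (ps ! j \<^bold>\<rightarrow> ps ! i))"
      using assms(1) by (auto simp: derivation_K_def)
    moreover have "(ps @ [A]) ! j = ps ! j" if "j \<le> i" for j
      using that True by (simp add: nth_append)
    ultimately show ?thesis
      by (metis le_refl less_imp_le)
  next
    case False
    then have "i = length ps" using i by simp
    then show ?thesis
      using assms(2) by (fastforce simp: in_set_conv_nth nth_append)
  qed
qed

lemma derives_K_iff_prov: "\<Gamma> \<turnstile>\<^sub>K A \<longleftrightarrow> prov \<Gamma> A"
proof
  assume "\<Gamma> \<turnstile>\<^sub>K A"
  then obtain ps where ps: "ps \<noteq> []" "derivation_K \<Gamma> ps" "last ps = A"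
    by (auto simp: derives_K_def)
  have "prov \<Gamma> (ps ! i)" if "i < length ps" for i
    using that
  \<comment> \<open>Strong induction, since the premises of Modus Ponens may stand anywhere before
    \<open>i\<close>.\<close>
  proof (induction i rule: less_induct)
    case (less i)
    then consider "ps ! i \<in> \<Gamma>" | "axiom_K (ps ! i)"
      | j k where "j < i" "k < i" "ps ! k = (ps ! j \<^bold>\<rightarrow> ps ! i)"
      using ps(2) by (auto simp: derivation_K_def)
    then show ?case
    proof cases
      case 3
      then have "prov \<Gamma> (ps ! j \<^bold>\<rightarrow> ps ! i)" "prov \<Gamma> (ps ! j)"
        using less.IH[of k] less.IH[of j] less.prems by auto
      then show ?thesis by (rule mp)
    qed (auto intro: hyp ax)
  qed
  then show "prov \<Gamma> A" 
    using ps by (auto simp: last_conv_nth)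
next
  assume "prov \<Gamma> A"
  then show "\<Gamma> \<turnstile>\<^sub>K A"
  proof induction
    case (hyp A)
    then have "derivation_K \<Gamma> [A]" by (simp add: derivation_K_def)
    then show ?case by (force simp: derives_K_def)
  next
    case (ax A)
    then have "derivation_K \<Gamma> [A]" by (simp add: derivation_K_def)
    then show ?case by (force simp: derives_K_def)
  next
    case (mp A B)
    then obtain ps qs where
      "ps \<noteq> []" "derivation_K \<Gamma> ps" "last ps = (A \<^bold>\<rightarrow> B)"
      "qs \<noteq> []" "derivation_K \<Gamma> qs" "last qs = A"
      by (auto simp: derives_K_def)
    \<comment> \<open>Both premises precede \<open>B\<close> in the concatenation, as the last
      entries of \<open>ps\<close> and of \<open>qs\<close>.\<close>
    then have "derivation_K \<Gamma> ((ps @ qs) @ [B])"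
      by (intro derivation_K_snoc derivation_K_append) (auto dest: last_in_set)
    then show ?case
      unfolding derives_K_def by (intro exI[of _ "(ps @ qs) @ [B]"]) simp
  qed
qed

text \<open>Designation depends on the first bit alone, and for it Ax1 to Ax3 are Boolean
  tautologies. The first bit of \<open>\<ominus> A\<close> is the second bit of \<open>A\<close>, so
  validity of K is the condition defining \<open>\<F>\<^sub>K\<close>.\<close>

lemma soundness:
  assumes "prov \<Gamma> A"
  shows "\<Gamma> \<Turnstile>\<^sub>K A"
proof -
  have D4_iff: "z \<in> D4 \<longleftrightarrow> fst z" for z
    by (cases z) (auto simp: D4_def)
  have "fst (v A)" if v: "v \<in> \<F>\<^sub>K" and \<Gamma>: "\<forall>B \<in> \<Gamma>. fst (v B)" for v
    using assms
  proof induction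
    case (ax A)
    then show ?case using v by cases (auto simp: \<F>\<^sub>K_def \<F>_def)
  qed (use v \<Gamma> in \<open>auto simp: \<F>\<^sub>K_def \<F>_def\<close>)
  then show ?thesis
    by (simp add: rn_entails_def RM\<^sub>K_def M4_def D4_iff)
qed

lemma prov_weaken: "prov \<Gamma> B \<Longrightarrow> prov \<Gamma> (A \<^bold>\<rightarrow> B)"
  by (rule mp[OF ax[OF Ax1]])

lemma prov_imp_mp:
  "prov \<Gamma> (A \<^bold>\<rightarrow> B \<^bold>\<rightarrow> C) \<Longrightarrow> prov \<Gamma> (A \<^bold>\<rightarrow> B) \<Longrightarrow> prov \<Gamma> (A \<^bold>\<rightarrow> C)"
  by (rule mp[OF mp[OF ax[OF Ax2]]])

text \<open>The combinator identity I = SKK, with \<open>Imp A A\<close> as the middle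
  formula.\<close>

lemma prov_imp_self: "prov \<Gamma> (A \<^bold>\<rightarrow> A)"
  by (rule prov_imp_mp[OF ax[OF Ax1] ax[OF Ax1[where B = A]]])

lemma prov_contra_neg: "prov \<Gamma> (\<^bold>\<not> B \<^bold>\<rightarrow> \<^bold>\<not> A) \<Longrightarrow> prov \<Gamma> (A \<^bold>\<rightarrow> B)"
  by (rule mp[OF ax[OF Ax3]])

lemma prov_mono: "prov \<Gamma> A \<Longrightarrow> \<Gamma> \<subseteq> \<Delta> \<Longrightarrow> prov \<Delta> A"
  by (induction rule: prov.induct) (blast intro: hyp ax, blast intro: ax, rule mp)

text \<open>The deduction theorem. Modus Ponens is the only rule, and Ax2 carries it through under
  the hypothesis \<open>A\<close>.\<close>

lemma prov_insert_iff: "prov (insert A \<Gamma>) B \<longleftrightarrow> prov \<Gamma> (A \<^bold>\<rightarrow> B)"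
proof
  show "prov (insert A \<Gamma>) B \<Longrightarrow> prov \<Gamma> (A \<^bold>\<rightarrow> B)"
  proof (induction rule: prov.induct)
    case (mp B C)
    show ?case using mp.IH by (rule prov_imp_mp)
  qed (auto intro: prov_weaken prov_imp_self hyp ax)
next
  assume "prov \<Gamma> (A \<^bold>\<rightarrow> B)"
  then have "prov (insert A \<Gamma>) (A \<^bold>\<rightarrow> B)" by (rule prov_mono) blast
  then show "prov (insert A \<Gamma>) B" by (rule mp) (simp add: hyp)
qed

lemma prov_explosion: "prov \<Gamma> (\<^bold>\<not> A) \<Longrightarrow> prov \<Gamma> A \<Longrightarrow> prov \<Gamma> B"
  by (rule mp[OF prov_contra_neg[OF prov_weaken]])

text \<open>In a context containing \<open>\<^bold>\<not> A\<close>, the hypothesis \<open>\<^bold>\<not> A \<^bold>\<rightarrow> A\<close> yields every formula, in particular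
  its own negation; contraposition then gives \<open>A\<close>.\<close>

lemma prov_clavius:
  assumes "prov \<Gamma> (\<^bold>\<not> A \<^bold>\<rightarrow> A)"
  shows "prov \<Gamma> A"
proof -
  have "prov (insert (\<^bold>\<not> A) \<Gamma>) (\<^bold>\<not> (\<^bold>\<not> A \<^bold>\<rightarrow> A))"
    by (rule prov_explosion[where A = A]) (simp_all add: prov_insert_iff prov_imp_self assms)
  then have "prov \<Gamma> ((\<^bold>\<not> A \<^bold>\<rightarrow> A) \<^bold>\<rightarrow> A)"
    by (simp add: prov_insert_iff prov_contra_neg)
  then show ?thesis
    using assms by (rule mp)
qed

text \<open>Weakening by \<open>Neg A\<close> and then Ax3 give \<open>Imp (Neg A) A\<close>, where
  \<open>prov_clavius\<close> applies.\<close>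

lemma prov_double_neg_elim: "prov \<Gamma> (\<^bold>\<not> \<^bold>\<not> A) \<Longrightarrow> prov \<Gamma> A"
  by (rule prov_clavius[OF prov_contra_neg[OF prov_weaken]])

lemma prov_double_neg_intro: "prov \<Gamma> A \<Longrightarrow> prov \<Gamma> (\<^bold>\<not> \<^bold>\<not> A)"
proof (erule mp[rotated], rule prov_contra_neg)
  \<comment> \<open>By Ax3 it is enough to eliminate a double negation in front of
    \<open>Neg A\<close>.\<close>
  show "prov \<Gamma> (\<^bold>\<not> \<^bold>\<not> \<^bold>\<not> A \<^bold>\<rightarrow> \<^bold>\<not> A)"
    unfolding prov_insert_iff[symmetric] by (rule prov_double_neg_elim) (simp add: hyp)
qed

text \<open>Ax3 only strips negations, so the implication is first lifted to doubly negated
  formulas.\<close>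

lemma prov_contrapos:
  assumes "prov \<Gamma> (A \<^bold>\<rightarrow> B)"
  shows "prov \<Gamma> (\<^bold>\<not> B \<^bold>\<rightarrow> \<^bold>\<not> A)"
proof (rule prov_contra_neg)
  have "prov (insert (\<^bold>\<not> \<^bold>\<not> A) \<Gamma>) (A \<^bold>\<rightarrow> B)"
    using assms by (rule prov_mono) blast
  moreover have "prov (insert (\<^bold>\<not> \<^bold>\<not> A) \<Gamma>) A"
    by (rule prov_double_neg_elim) (simp add: hyp)
  ultimately have "prov (insert (\<^bold>\<not> \<^bold>\<not> A) \<Gamma>) (\<^bold>\<not> \<^bold>\<not> B)"
    by (rule prov_double_neg_intro[OF mp])
  then show "prov \<Gamma> (\<^bold>\<not> \<^bold>\<not> A \<^bold>\<rightarrow> \<^bold>\<not> \<^bold>\<not> B)"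
    by (simp add: prov_insert_iff)
qed

lemma prov_cases:
  assumes "prov (insert A \<Gamma>) B" "prov (insert (\<^bold>\<not> A) \<Gamma>) B"
  shows "prov \<Gamma> B"
proof (rule prov_clavius)
  have "prov \<Gamma> (\<^bold>\<not> B \<^bold>\<rightarrow> \<^bold>\<not> A)" "prov \<Gamma> (\<^bold>\<not> A \<^bold>\<rightarrow> B)"
    using assms by (simp_all add: prov_insert_iff prov_contrapos)
  then show "prov \<Gamma> (\<^bold>\<not> B \<^bold>\<rightarrow> B)"
    \<comment> \<open>Chains the two implications through \<open>Neg A\<close>.\<close>
    by (rule prov_imp_mp[OF prov_weaken, rotated])
qed

text \<open>Compactness along a chain: of the sets supporting the two premises, the larger supports
  both. Nonemptiness of \<open>C\<close> provides a set for the axioms.\<close>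

lemma prov_Union_chain:
  assumes "prov (\<Union> C) A" "C \<noteq> {}" "subset.chain S C"
  shows "\<exists>X \<in> C. prov X A"
  using assms(1)
proof induction
  case (mp A B)
  then obtain X Y where "X \<in> C" "prov X (A \<^bold>\<rightarrow> B)" "Y \<in> C" "prov Y A" by blast
  moreover have "X \<subseteq> Y \<or> Y \<subseteq> X"
    using assms(3) calculation by (auto simp: subset_chain_def)
  ultimately show ?case by (meson prov.mp prov_mono)
qed (use assms(2) in \<open>auto intro: hyp ax\<close>)

text \<open>Zorn's lemma on the extensions of \<open>\<Gamma>\<close> that do not prove
  \<open>A\<close>; maximality is recorded for one added formula at a time.\<close>

lemma lindenbaum:
  assumes "\<not> prov \<Gamma> A"
  obtains \<Delta> where "\<Gamma> \<subseteq> \<Delta>" "\<not> prov \<Delta> A" "\<And>B. B \<notin> \<Delta> \<Longrightarrow> prov (insert B \<Delta>) A"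
proof -
  let ?S = "{\<Delta>. \<Gamma> \<subseteq> \<Delta> \<and> \<not> prov \<Delta> A}"
  have "\<exists>\<Delta>\<in>?S. \<forall>X\<in>?S. \<Delta> \<subseteq> X \<longrightarrow> X = \<Delta>"
  proof (rule subset_Zorn_nonempty)
    show "?S \<noteq> {}" using assms by blast
    show "\<Union> C \<in> ?S" if "C \<noteq> {}" and chain: "subset.chain ?S C" for C
    proof -
      have "C \<subseteq> ?S" using chain by (simp add: subset_chain_def)
      then show ?thesis using prov_Union_chain[OF _ that] that(1) by blast
    qed
  qed
  then obtain \<Delta> where \<Delta>: "\<Gamma> \<subseteq> \<Delta>" "\<not> prov \<Delta> A"
    and max: "\<And>X. \<Gamma> \<subseteq> X \<Longrightarrow> \<not> prov X A \<Longrightarrow> \<Delta> \<subseteq> X \<Longrightarrow> X = \<Delta>"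
    by auto
  have "prov (insert B \<Delta>) A" if "B \<notin> \<Delta>" for B
    using max[of "insert B \<Delta>"] \<Delta>(1) that by blast
  then show ?thesis using \<Delta> that by blast
qed

lemma completeness:
  assumes "\<Gamma> \<Turnstile>\<^sub>K A"
  shows "prov \<Gamma> A"
proof (rule ccontr)
  assume "\<not> prov \<Gamma> A"
  then obtain \<Delta> where \<Delta>: "\<Gamma> \<subseteq> \<Delta>" "\<not> prov \<Delta> A"
    and max: "\<And>B. B \<notin> \<Delta> \<Longrightarrow> prov (insert B \<Delta>) A"
    by (rule lindenbaum) blast
  \<comment> \<open>If \<open>\<Delta>\<close> proved some \<open>B\<close> outside it, maximality
    would give \<open>Imp B A\<close> and hence \<open>A\<close>.\<close>
  have mem: "B \<in> \<Delta> \<longleftrightarrow> prov \<Delta> B" for B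
    using max[of B] \<Delta>(2) by (auto simp: prov_insert_iff intro: hyp dest: mp)
  \<comment> \<open>With both formulas outside, case distinction proves \<open>A\<close>; with both
    inside, explosion does.\<close>
  have neg: "(\<^bold>\<not> B) \<in> \<Delta> \<longleftrightarrow> B \<notin> \<Delta>" for B
    using max[of B] max[of "\<^bold>\<not> B"] \<Delta>(2) mem[of B] mem[of "\<^bold>\<not> B"]
      prov_cases[of B \<Delta> A] prov_explosion[of \<Delta> B A] by blast
  \<comment> \<open>If \<open>B\<close> is not in \<open>\<Delta>\<close>, then \<open>Neg B\<close>
    is, and Ax1 with Ax3 yields the implication; if \<open>C\<close> is in \<open>\<Delta>\<close>,
    Ax1 suffices.\<close>
  have imp: "(B \<^bold>\<rightarrow> C) \<in> \<Delta> \<longleftrightarrow> (B \<in> \<Delta> \<longrightarrow> C \<in> \<Delta>)" for B C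
    using neg[of B] mem[of B] mem[of C] mem[of "\<^bold>\<not> B"] mem[of "B \<^bold>\<rightarrow> C"]
      mp[of \<Delta> B C] prov_contra_neg[OF prov_weaken, of \<Delta> B C] prov_weaken[of \<Delta> C B] by blast
  define v where "v B = (B \<in> \<Delta>, (\<ominus> B) \<in> \<Delta>)" for B
  have "(\<ominus> (B \<^bold>\<rightarrow> C)) \<in> \<Delta> \<Longrightarrow> (\<ominus> B) \<in> \<Delta> \<Longrightarrow> (\<ominus> C) \<in> \<Delta>" for B C
    unfolding mem by (rule mp[OF mp[OF ax[OF K]]])
  \<comment> \<open>The first bits obey \<open>neg\<close> and \<open>imp\<close>, the clause for
    \<open>\<ominus>\<close> holds by the choice of second bit, and the K step gives the
    restriction.\<close>
  then have "v \<in> \<F>\<^sub>K"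
    by (auto simp: \<F>\<^sub>K_def \<F>_def v_def neg imp)
  moreover have "\<forall>B \<in> \<Gamma>. v B \<in> D4" "v A \<notin> D4"
    using \<Delta> mem by (auto simp: v_def D4_def)
  ultimately show False
    using assms by (auto simp: rn_entails_def RM\<^sub>K_def M4_def)
qed

theorem theorem3:
  fixes \<Gamma> :: "fm set" and A :: fm
  shows "\<Gamma> \<turnstile>\<^sub>K A \<longleftrightarrow> \<Gamma> \<Turnstile>\<^sub>K A"
  using derives_K_iff_prov soundness completeness by blast

end
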